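(* Let $(X,T,m)$ be an ergodic measure-preserving system ($m$ a $T$-invariant ergodic probability measure on $X$), and let $f\colon X\to\mathbb{R}$ be a measurable observable, integrable with $\int f\,dm=0$. Write $S_nf=f+f\circ T+\cdots+f\circ T^{n-1}$, and for $\varepsilon>0$, $n\ge 1$ let \[\Lambda_n^+(\varepsilon)=m\left\{x\in X:\tfrac{S_nf(x)}{n}\ge\varepsilon\right\},\qquad \Lambda_n^-(\varepsilon)=m\left\{x\in X:\tfrac{S_nf(x)}{n}\le-\varepsilon\right\}.\] Suppose that the following two hypotheses hold. (CLT) There exists $0<\sigma<\infty$ such that $\frac{S_nf}{\sigma\sqrt n}$ converges in distribution (with respect to $m$) to the standard normal law $\mathcal N(0,1)$ as $n\to\infty$. (LD) There exist constants $\delta>0$, $M>0$, $C>0$ and a $C^2$ function $I\colon(-\delta,\delta)\to[0,\infty)$ such that $I(0)=0$, $I'(0)=0$, $I''(0)>0$, and such that for any $n\ge1$ and any $\varepsilon\in(0,\delta)$ with $\varepsilon>M/n$, \[\Lambda_n^+(\varepsilon)\le Ce^{-I(\varepsilon)n}\quad\text{and}\quad \Lambda_n^-(\varepsilon)\le Ce^{-I(-\varepsilon)n}.\] Then, with $\Lambda(\varepsilon)=\sum_{n=1}^\infty\Lambda_n^+(\varepsilon)+\sum_{n=1}^\infty\Lambda_n^-(\varepsilon)$, \[\lim_{\varepsilon\to0}\varepsilon^2\Lambda(\varepsilon)=\sigma^2.\]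
   Context: The parameter $\varepsilon$ is always positive, so $\varepsilon\to0$ means $\varepsilon\to0^+$. *)

theory Defs
  imports "HOL-Probability.Probability"
begin

locale ergodic_mps = prob_space m for m :: "'a measure" +
  fixes T :: "'a \<Rightarrow> 'a"
  assumes T_measurable: "T \<in> measurable m m"
    and T_invariant: "distr m m T = m"
    and T_ergodic: "\<And>A. A \<in> sets m \<Longrightarrow> T -` A \<inter> space m = A \<Longrightarrow>
      measure m A = 0 \<or> measure m A = 1"

definition birkhoff_sum :: "('a \<Rightarrow> 'a) \<Rightarrow> ('a \<Rightarrow> real) \<Rightarrow> nat \<Rightarrow> 'a \<Rightarrow> real" where
  "birkhoff_sum T f n x = (\<Sum>k<n. f ((T ^^ k) x))"

definition Lambda_plus ::
  "'a measure \<Rightarrow> ('a \<Rightarrow> 'a) \<Rightarrow> ('a \<Rightarrow> real) \<Rightarrow> nat \<Rightarrow> real \<Rightarrow> real" where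
  "Lambda_plus m T f n \<epsilon> = measure m {x \<in> space m. birkhoff_sum T f n x / real n \<ge> \<epsilon>}"

definition Lambda_minus ::
  "'a measure \<Rightarrow> ('a \<Rightarrow> 'a) \<Rightarrow> ('a \<Rightarrow> real) \<Rightarrow> nat \<Rightarrow> real \<Rightarrow> real" where
  "Lambda_minus m T f n \<epsilon> = measure m {x \<in> space m. birkhoff_sum T f n x / real n \<le> - \<epsilon>}"

text \<open>The series has nonnegative terms and may diverge for some \<open>\<epsilon>\<close>, so its sum is taken in
  \<open>[0, \<infinity>]\<close>.  The index shift makes both sums start at \<open>n = 1\<close>.\<close>

definition Lambda_total ::
  "'a measure \<Rightarrow> ('a \<Rightarrow> 'a) \<Rightarrow> ('a \<Rightarrow> real) \<Rightarrow> real \<Rightarrow> ennreal" where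
  "Lambda_total m T f \<epsilon> =
    (\<Sum>n. ennreal (Lambda_plus m T f (Suc n) \<epsilon>)) + (\<Sum>n. ennreal (Lambda_minus m T f (Suc n) \<epsilon>))"

text \<open>Intended for open \<open>S\<close>, since all derivatives are two-sided.\<close>

definition C2_differentiable_on :: "(real \<Rightarrow> real) \<Rightarrow> real set \<Rightarrow> bool"
    (infix "C2'_differentiable'_on" 50) where
  "g C2_differentiable_on S \<longleftrightarrow> g C1_differentiable_on S \<and> deriv g C1_differentiable_on S"

end

theory Submission
  imports Defs
begin

text \<open>
  Up to the factor \<open>\<epsilon>\<^sup>2\<close>, the series is a Riemann sum of mesh \<open>\<epsilon>\<^sup>2\<close>: with \<open>n = \<lfloor>t / \<epsilon>\<^sup>2\<rfloor> + 1\<close>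
  it equals the integral over \<open>t \<ge> 0\<close> of the probability that \<open>\<bar>S\<^sub>n f\<bar> / (\<sigma> \<surd>n) \<ge> \<epsilon> \<surd>n / \<sigma>\<close>.
  As \<open>\<epsilon> \<surd>n \<longlongrightarrow> \<surd>t\<close>, the central limit theorem gives the pointwise limit \<open>P(\<bar>Z\<bar> \<ge> \<surd>t / \<sigma>)\<close> with
  \<open>Z\<close> standard normal. Near \<open>0\<close> the rate function is at least \<open>c \<epsilon>\<^sup>2\<close>, so the large deviation
  bound supplies the integrable majorant \<open>K exp (- c t)\<close>. The limit integral is the second
  moment of \<open>\<sigma> Z\<close>.
\<close>

section \<open>Series and tail integrals over the half-line\<close>

text \<open>The integrand is a step function with value \<open>a k\<close> on a cell of length
  \<open>h\<close>, and the cells tile the half-line. Working in \<open>ennreal\<close> allows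
  termwise integration without any convergence assumption, so a divergent series is covered
  too.\<close>

lemma suminf_eq_nn_integral_floor:
  fixes a :: "nat \<Rightarrow> ennreal"
  assumes "0 < h"
  shows "ennreal h * (\<Sum>k. a k) = (\<integral>\<^sup>+t. a (nat \<lfloor>t / h\<rfloor>) * indicator {0..} t \<partial>lborel)"
proof -
  define A where "A k = {real k * h..<(real k + 1) * h}" for k :: nat
  have mem_iff: "t \<in> A k \<longleftrightarrow> 0 \<le> t \<and> nat \<lfloor>t / h\<rfloor> = k" for t k
  proof
    assume t: "t \<in> A k"
    then have "real k \<le> t / h" "t / h < real k + 1"
      using assms by (simp_all add: A_def pos_le_divide_eq pos_divide_less_eq)
    then have "\<lfloor>t / h\<rfloor> = int k" by (simp add: floor_eq_iff)
    moreover have "0 \<le> real k * h" using assms by simp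
    then have "0 \<le> t" using t unfolding A_def by simp
    ultimately show "0 \<le> t \<and> nat \<lfloor>t / h\<rfloor> = k" by simp
  next
    assume t: "0 \<le> t \<and> nat \<lfloor>t / h\<rfloor> = k"
    then have "0 \<le> t / h" using assms by simp
    then have "\<lfloor>t / h\<rfloor> = int k" using t by auto
    then have "real k \<le> t / h" "t / h < real k + 1" by (simp_all add: floor_eq_iff)
    then show "t \<in> A k"
      using assms by (simp add: A_def pos_le_divide_eq pos_divide_less_eq)
  qed
  have disj: "disjoint_family A"
    unfolding disjoint_family_on_def by (auto simp: mem_iff)
  \<comment> \<open>For \<open>t\<close> nonnegative exactly one cell contains \<open>t\<close>, so
    one term of the series survives; for negative \<open>t\<close> none does.\<close>
  have "a (nat \<lfloor>t / h\<rfloor>) * indicator {0..} t = (\<Sum>k. a k * indicator (A k) t)" for t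
  proof (cases "0 \<le> t")
    case True
    then have "t \<in> A (nat \<lfloor>t / h\<rfloor>)" by (simp add: mem_iff)
    then show ?thesis using suminf_cmult_indicator[OF disj, of t _ a] True by simp
  next
    case False
    then have "t \<notin> A k" for k by (simp add: mem_iff)
    then show ?thesis using False by simp
  qed
  then have "(\<integral>\<^sup>+t. a (nat \<lfloor>t / h\<rfloor>) * indicator {0..} t \<partial>lborel)
      = (\<integral>\<^sup>+t. (\<Sum>k. a k * indicator (A k) t) \<partial>lborel)" by simp
  also have "\<dots> = (\<Sum>k. \<integral>\<^sup>+t. a k * indicator (A k) t \<partial>lborel)"
    by (rule nn_integral_suminf) (simp add: A_def)
  also have "\<dots> = (\<Sum>k. ennreal h * a k)"
  proof (rule suminf_cong)
    fix k
    have "emeasure lborel (A k) = ennreal ((real k + 1) * h - real k * h)"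
      unfolding A_def using assms by (intro emeasure_lborel_Ico) simp
    also have "\<dots> = ennreal h" by (simp add: algebra_simps)
    finally show "(\<integral>\<^sup>+t. a k * indicator (A k) t \<partial>lborel) = ennreal h * a k"
      by (subst nn_integral_cmult_indicator) (auto simp: A_def mult.commute)
  qed
  finally show ?thesis by simp
qed

text \<open>Layer-cake formula: Tonelli on the region \<open>0 \<le> t \<le> s^2 * y^2\<close>,
  whose sections at fixed \<open>y\<close> are intervals of length \<open>s^2 * y^2\<close>. With
  \<open>s\<close> = \<sigma> it turns the limit integral into a second moment.\<close>

lemma nn_integral_emeasure_abs_tail:
  fixes M :: "real measure"
  assumes "sigma_finite_measure M" and sets_M [measurable_cong]: "sets M = sets borel" and "0 < s"
  shows "(\<integral>\<^sup>+t. emeasure M {y. sqrt t / s \<le> \<bar>y\<bar>} * indicator {0..} t \<partial>lborel)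
    = (\<integral>\<^sup>+y. ennreal (s\<^sup>2 * y\<^sup>2) \<partial>M)"
proof -
  interpret M: sigma_finite_measure M by fact
  interpret pair_sigma_finite lborel M ..
  have iff: "sqrt t / s \<le> \<bar>y\<bar> \<longleftrightarrow> t \<le> s\<^sup>2 * y\<^sup>2" if "0 \<le> t" for t y
  proof -
    have "sqrt t / s \<le> \<bar>y\<bar> \<longleftrightarrow> sqrt t \<le> \<bar>s * y\<bar>"
      using assms(3) by (simp add: divide_le_eq abs_mult mult.commute)
    also have "\<bar>s * y\<bar> = sqrt ((s * y)\<^sup>2)" by simp
    also have "sqrt t \<le> sqrt ((s * y)\<^sup>2) \<longleftrightarrow> t \<le> (s * y)\<^sup>2"
      by (rule real_sqrt_le_iff)
    finally show ?thesis by (simp add: power_mult_distrib)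
  qed
  have "emeasure M {y. sqrt t / s \<le> \<bar>y\<bar>} * indicator {0..} t
      = (\<integral>\<^sup>+y. indicator {0..s\<^sup>2 * y\<^sup>2} t \<partial>M)" for t
  proof (cases "0 \<le> t")
    case True
    have "(\<integral>\<^sup>+y. indicator {0..s\<^sup>2 * y\<^sup>2} t \<partial>M)
        = (\<integral>\<^sup>+y. indicator {y. sqrt t / s \<le> \<bar>y\<bar>} y \<partial>M)"
      using True by (intro nn_integral_cong) (auto simp: indicator_def iff)
    also have "\<dots> = emeasure M {y. sqrt t / s \<le> \<bar>y\<bar>}"
      by (rule nn_integral_indicator) measurable
    finally show ?thesis using True by simp
  qed simp
  then have "(\<integral>\<^sup>+t. emeasure M {y. sqrt t / s \<le> \<bar>y\<bar>} * indicator {0..} t \<partial>lborel)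
      = (\<integral>\<^sup>+t. \<integral>\<^sup>+y. indicator {0..s\<^sup>2 * y\<^sup>2} t \<partial>M \<partial>lborel)" by simp
  also have "\<dots> = (\<integral>\<^sup>+y. \<integral>\<^sup>+t. indicator {0..s\<^sup>2 * y\<^sup>2} t \<partial>lborel \<partial>M)"
    by (rule Fubini'[symmetric]) (simp add: indicator_def)
  also have "\<dots> = (\<integral>\<^sup>+y. ennreal (s\<^sup>2 * y\<^sup>2) \<partial>M)" by simp
  finally show ?thesis .
qed

section \<open>Two-sided tails under weak convergence\<close>

text \<open>The tail is the sum of a left tail and a right tail, both expressed by the cdf, which is
  continuous in the absence of atoms. Positivity of \<open>x\<close> keeps the two tails
  disjoint.\<close>

lemma (in real_distribution) isCont_measure_abs_tail:
  assumes diffuse: "\<And>y. measure M {y} = 0" and "0 < x"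
  shows "isCont (\<lambda>x. measure M {y. x \<le> \<bar>y\<bar>}) x"
proof -
  have eq: "measure M {y. x \<le> \<bar>y\<bar>} = cdf M (- x) + (1 - cdf M x)" if "0 < x" for x
  proof -
    have "{y. x \<le> \<bar>y\<bar>} = {..- x} \<union> {x} \<union> (UNIV - {..x})" by (auto simp: abs_if)
    also have "measure M \<dots> = measure M {..- x} + measure M {x} + measure M (UNIV - {..x})"
    proof -
      have "measure M ({..- x} \<union> {x} \<union> (UNIV - {..x}))
          = measure M ({..- x} \<union> {x}) + measure M (UNIV - {..x})"
        using that by (intro finite_measure_Union) auto
      also have "measure M ({..- x} \<union> {x}) = measure M {..- x} + measure M {x}"
        using that by (intro finite_measure_Union) auto
      finally show ?thesis .
    qed
    also have "measure M (UNIV - {..x}) = 1 - measure M {..x}"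
      using prob_compl[of "{..x}"] by simp
    finally show ?thesis by (simp add: cdf_def diffuse)
  qed
  have cont: "isCont (cdf M) z" for z by (simp add: isCont_cdf diffuse)
  have "isCont (\<lambda>x. cdf M (- x) + (1 - cdf M x)) x"
    by (intro continuous_intros isCont_o2[OF _ cont] cont)
  \<comment> \<open>The cdf formula is established for positive arguments only, so continuity is
    transferred through the neighbourhood \<open>{0<..}\<close> of \<open>x\<close>.\<close>
  moreover have "eventually (\<lambda>z. measure M {y. z \<le> \<bar>y\<bar>} = cdf M (- z) + (1 - cdf M z)) (nhds x)"
    using eventually_nhds_in_open[of "{0<..}" x] assms(2) by (auto elim!: eventually_mono simp: eq)
  ultimately show ?thesis using isCont_cong by fast
qed

text \<open>Index and threshold move at the same time. Tails decrease in the threshold, so the tail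
  at \<open>x i\<close> is squeezed between those at two fixed thresholds close to \<open>z\<close>;
  weak convergence handles these, and continuity of the limit tail closes the gap.\<close>

lemma weak_conv_abs_tail:
  fixes \<mu> :: "nat \<Rightarrow> real measure" and M :: "real measure"
  assumes \<mu>: "\<And>n. real_distribution (\<mu> n)" and M: "real_distribution M"
    and conv: "weak_conv_m \<mu> M" and diffuse: "\<And>y. measure M {y} = 0"
    and k: "filterlim k at_top F" and x: "(x \<longlongrightarrow> z) F" and z: "0 < z"
  shows "((\<lambda>i. measure (\<mu> (k i)) {y. x i \<le> \<bar>y\<bar>}) \<longlongrightarrow> measure M {y. z \<le> \<bar>y\<bar>}) F"
proof -
  interpret M: real_distribution M by fact
  interpret \<mu>: real_distribution "\<mu> n" for n by fact
  let ?A = "\<lambda>w. {y::real. w \<le> \<bar>y\<bar>}"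
  have A [measurable]: "?A w \<in> sets borel" for w by measurable
  have mono: "measure (\<mu> n) (?A v) \<le> measure (\<mu> n) (?A w)" if "w \<le> v" for n v w
    using that by (intro \<mu>.finite_measure_mono) auto
  have lim: "((\<lambda>i. measure (\<mu> (k i)) (?A w)) \<longlongrightarrow> measure M (?A w)) F" for w
  proof -
    have op: "open {y::real. w < \<bar>y\<bar>}"
      by (intro open_Collect_less continuous_intros)
    have cl: "closed (?A w)" by (intro closed_Collect_le continuous_intros)
    \<comment> \<open>The frontier lies in the two points \<open>w\<close> and \<open>- w\<close>,
      which are null for \<open>M\<close>; hence \<open>?A w\<close> is a continuity set of
      \<open>M\<close> and the portmanteau theorem applies.\<close>
    have "{y. w < \<bar>y\<bar>} \<subseteq> interior (?A w)" by (rule interior_maximal[OF _ op]) auto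
    then have "frontier (?A w) \<subseteq> ?A w - {y. w < \<bar>y\<bar>}"
      using cl unfolding frontier_def by auto
    also have "\<dots> \<subseteq> {w} \<union> {- w}" by auto
    finally have "frontier (?A w) \<subseteq> {w} \<union> {- w}" .
    moreover have "emeasure M ({w} \<union> {- w}) = 0"
      using emeasure_subadditive[of "{w}" M "{- w}"] by (simp add: M.emeasure_eq_measure diffuse)
    ultimately have "emeasure M (frontier (?A w)) = 0"
      using emeasure_mono[of "frontier (?A w)" "{w} \<union> {- w}" M] by simp
    then have "(\<lambda>n. measure (\<mu> n) (?A w)) \<longlonglongrightarrow> measure M (?A w)"
      by (intro weak_conv_imp_continuity_set_conv[OF \<mu> M conv]) auto
    then show ?thesis by (rule filterlim_compose[OF _ k])
  qed
  show ?thesis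
  proof (rule tendstoI)
    fix e :: real assume e: "0 < e"
    have "isCont (\<lambda>w. measure M (?A w)) z" using M.isCont_measure_abs_tail diffuse z by blast
    then obtain d where d: "0 < d"
        "\<And>w. dist w z < d \<Longrightarrow> dist (measure M (?A w)) (measure M (?A z)) < e / 2"
      using e unfolding continuous_at_eps_delta by (metis half_gt_zero dist_commute)
    let ?l = "z - d / 2" and ?u = "z + d / 2"
    have near: "dist (measure M (?A ?l)) (measure M (?A z)) < e / 2"
        "dist (measure M (?A ?u)) (measure M (?A z)) < e / 2"
      using d by (auto simp: dist_real_def)
    have "eventually (\<lambda>i. dist (x i) z < d / 2) F" using d by (intro tendstoD[OF x]) simp
    moreover have "eventually (\<lambda>i. dist (measure (\<mu> (k i)) (?A ?l)) (measure M (?A ?l)) < e / 2) F"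
      using e by (intro tendstoD[OF lim]) simp
    moreover have "eventually (\<lambda>i. dist (measure (\<mu> (k i)) (?A ?u)) (measure M (?A ?u)) < e / 2) F"
      using e by (intro tendstoD[OF lim]) simp
    ultimately show
      "eventually (\<lambda>i. dist (measure (\<mu> (k i)) (?A (x i))) (measure M (?A z)) < e) F"
    proof eventually_elim
      case (elim i)
      have "x i \<le> ?u" "?l \<le> x i" using elim(1) unfolding dist_real_def by linarith+
      from mono[OF this(1), of "k i"] mono[OF this(2), of "k i"] show ?case
        using elim(2,3) near unfolding dist_real_def by linarith
    qed
  qed
qed

section \<open>Quadratic growth of the rate function and the integrable majorant\<close>

text \<open>With \<open>a\<close> the second derivative at 0, \<open>deriv g t / t\<close> tends to
  \<open>a\<close> and so exceeds \<open>a / 2\<close> near 0. Then \<open>g t - a / 4 * t^2\<close>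
  decreases before 0 and increases after it, which gives \<open>c = a / 4\<close>, half the Taylor
  coefficient.\<close>

lemma C2_quadratic_lower_bound:
  fixes g :: "real \<Rightarrow> real"
  assumes C2: "g C2_differentiable_on {-\<delta><..<\<delta>}" and \<delta>: "0 < \<delta>"
    and g0: "g 0 = 0" "deriv g 0 = 0" "deriv (deriv g) 0 > 0"
  obtains c r where "0 < c" "0 < r" "r \<le> \<delta>" "\<And>t. \<bar>t\<bar> < r \<Longrightarrow> c * t\<^sup>2 \<le> g t"
proof -
  define a where "a = deriv (deriv g) 0"
  have a: "0 < a" using g0 by (simp add: a_def)
  have g': "(g has_real_derivative deriv g t) (at t)" if "t \<in> {-\<delta><..<\<delta>}" for t
    using C2 that unfolding C2_differentiable_on_def C1_differentiable_on_eq
    by (metis DERIV_deriv_iff_real_differentiable)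
  have "(deriv g has_real_derivative a) (at 0)"
    using C2 \<delta> unfolding C2_differentiable_on_def C1_differentiable_on_eq a_def
    by (metis DERIV_deriv_iff_real_differentiable greaterThanLessThan_iff neg_less_0_iff_less)
  then have "(\<lambda>t. deriv g t / t) \<midarrow>0\<rightarrow> a" by (simp add: DERIV_def g0)
  from order_tendstoD(1)[OF this, of "a / 2"]
  have "eventually (\<lambda>t. a / 2 < deriv g t / t) (at 0)"
    using a by simp
  then obtain r0 where r0: "0 < r0" "\<And>t. t \<noteq> 0 \<Longrightarrow> \<bar>t\<bar> < r0 \<Longrightarrow> a / 2 < deriv g t / t"
    unfolding eventually_at by (auto simp: dist_real_def)
  define r where "r = min r0 \<delta>"
  have deriv_h: "((\<lambda>t. g t - a / 4 * t\<^sup>2) has_real_derivative deriv g t - a / 2 * t) (at t)"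
    if "\<bar>t\<bar> < r" for t
    using that by (auto intro!: derivative_eq_intros g' simp: r_def)
  \<comment> \<open>The factor \<open>t\<close> states in one inequality that the derivative is
    nonnegative to the right of 0 and nonpositive to the left.\<close>
  have sign: "t * (deriv g t - a / 2 * t) \<ge> 0" if "\<bar>t\<bar> < r" for t
  proof (cases "t = 0")
    case False
    then have "t\<^sup>2 * (deriv g t / t - a / 2) \<ge> 0" using r0(2)[of t] that by (simp add: r_def)
    also have "t\<^sup>2 * (deriv g t / t - a / 2) = t * (deriv g t - a / 2 * t)"
      using False by (simp add: field_simps power2_eq_square)
    finally show ?thesis .
  qed simp
  show ?thesis
  proof
    show "0 < a / 4" "0 < r" "r \<le> \<delta>" using a r0 \<delta> by (auto simp: r_def)
    fix t :: real assume t: "\<bar>t\<bar> < r"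
    have "g 0 - a / 4 * 0\<^sup>2 \<le> g t - a / 4 * t\<^sup>2"
    proof (cases "0 \<le> t")
      case True
      show ?thesis
      proof (rule DERIV_nonneg_imp_nondecreasing[OF True])
        fix s assume s: "0 \<le> s" "s \<le> t"
        then have "0 \<le> deriv g s - a / 2 * s"
          \<comment> \<open>At \<open>s = 0\<close> the inequality \<open>sign\<close> says nothing
            about the derivative; there \<open>deriv g 0 = 0\<close> is used.\<close>
          using sign[of s] t g0 by (cases "s = 0") (auto simp: zero_le_mult_iff)
        then show "\<exists>y. ((\<lambda>t. g t - a / 4 * t\<^sup>2) has_real_derivative y) (at s) \<and> 0 \<le> y"
          using deriv_h[of s] s t by auto
      qed
    next
      case False
      then have "t \<le> 0" by simp
      then show ?thesis
      proof (rule DERIV_nonpos_imp_nonincreasing)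
        fix s assume s: "t \<le> s" "s \<le> 0"
        then have "deriv g s - a / 2 * s \<le> 0"
          using sign[of s] t g0 False by (cases "s = 0") (auto simp: zero_le_mult_iff)
        then show "\<exists>y. ((\<lambda>t. g t - a / 4 * t\<^sup>2) has_real_derivative y) (at s) \<and> y \<le> 0"
          using deriv_h[of s] s t by auto
      qed
    qed
    then show "a / 4 * t\<^sup>2 \<le> g t" by (simp add: g0)
  qed
qed

lemma nn_integral_exp_finite:
  fixes K c :: real
  assumes "0 \<le> K" "0 < c"
  shows "(\<integral>\<^sup>+t. ennreal (K * exp (- c * t)) * indicator {0..} t \<partial>lborel) < \<infinity>"
proof -
  have "(\<integral>\<^sup>+t. ennreal (K * exp (- c * t)) * indicator {0..} t \<partial>lborel)
      = ennreal (0 - (- K / c * exp (- c * 0)))"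
  proof (rule nn_integral_FTC_atLeast)
    show "((\<lambda>t. - K / c * exp (- c * t)) \<longlongrightarrow> 0) at_top"
      using assms(2)
      by (intro tendsto_mult_right_zero filterlim_compose[OF exp_at_bot]
        filterlim_tendsto_neg_mult_at_bot[OF tendsto_const _ filterlim_ident]) simp
  qed (use assms in \<open>auto intro!: derivative_eq_intros\<close>)
  then show ?thesis by simp
qed

section \<open>Normalised Birkhoff sums and the scaling of the index\<close>

lemma birkhoff_sum_measurable:
  assumes T: "T \<in> measurable m m" and f: "f \<in> borel_measurable m"
  shows "birkhoff_sum T f n \<in> borel_measurable m"
proof -
  have "(T ^^ k) \<in> measurable m m" for k
    by (induction k) (auto intro: measurable_compose[OF _ T])
  then have "(\<lambda>x. \<Sum>k<n. f ((T ^^ k) x)) \<in> borel_measurable m"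
    by (intro borel_measurable_sum measurable_compose[OF _ f])
  then show ?thesis unfolding birkhoff_sum_def[abs_def] .
qed

text \<open>The two deviation events are disjoint since \<epsilon> is positive, and multiplying
  \<epsilon> by \<open>sqrt n / \<sigma>\<close> passes from the mean to the normalisation of the
  central limit theorem.\<close>

lemma Lambda_plus_add_Lambda_minus:
  assumes "prob_space m" and [measurable]: "birkhoff_sum T f n \<in> borel_measurable m"
    and "1 \<le> n" "0 < \<epsilon>" "0 < \<sigma>"
  shows "Lambda_plus m T f n \<epsilon> + Lambda_minus m T f n \<epsilon>
    = measure (distr m borel (\<lambda>x. birkhoff_sum T f n x / (\<sigma> * sqrt (real n))))
        {y. \<epsilon> * sqrt (real n) / \<sigma> \<le> \<bar>y\<bar>}"
proof -
  interpret prob_space m by fact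
  let ?S = "birkhoff_sum T f n"
  let ?A = "{x \<in> space m. ?S x / real n \<ge> \<epsilon>}" and ?B = "{x \<in> space m. ?S x / real n \<le> - \<epsilon>}"
  have n: "0 < real n" using assms by simp
  have "\<epsilon> * sqrt (real n) / \<sigma> \<le> \<bar>s / (\<sigma> * sqrt (real n))\<bar> \<longleftrightarrow> \<epsilon> \<le> \<bar>s / real n\<bar>" for s
  proof -
    have "\<epsilon> * sqrt (real n) / \<sigma> \<le> \<bar>s / (\<sigma> * sqrt (real n))\<bar>
        \<longleftrightarrow> \<epsilon> * sqrt (real n) / \<sigma> * (\<sigma> * sqrt (real n)) \<le> \<bar>s\<bar>"
      using n assms by (simp add: abs_mult pos_le_divide_eq)
    also have "\<epsilon> * sqrt (real n) / \<sigma> * (\<sigma> * sqrt (real n)) = \<epsilon> * real n"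
      using n assms by simp
    also have "\<epsilon> * real n \<le> \<bar>s\<bar> \<longleftrightarrow> \<epsilon> \<le> \<bar>s / real n\<bar>"
      using n by (simp add: pos_le_divide_eq)
    finally show ?thesis .
  qed
  then have "(\<lambda>x. ?S x / (\<sigma> * sqrt (real n))) -` {y. \<epsilon> * sqrt (real n) / \<sigma> \<le> \<bar>y\<bar>} \<inter> space m
      = ?A \<union> ?B" by (auto simp: abs_if)
  then have "measure (distr m borel (\<lambda>x. ?S x / (\<sigma> * sqrt (real n))))
        {y. \<epsilon> * sqrt (real n) / \<sigma> \<le> \<bar>y\<bar>} = measure m (?A \<union> ?B)"
    by (subst measure_distr) auto
  also have "\<dots> = measure m ?A + measure m ?B"
    using assms by (intro finite_measure_Union) auto
  finally show ?thesis by (simp add: Lambda_plus_def Lambda_minus_def)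
qed

text \<open>Writing \<open>n\<close> for the index, rounding gives
  \<open>t \<le> (X i)^2 * n \<le> t + (X i)^2\<close>. A squeeze and a square root yield the second
  claim; the lower bound alone forces \<open>n\<close> to infinity.\<close>

lemma tendsto_mult_sqrt_floor:
  fixes X :: "nat \<Rightarrow> real"
  assumes X: "X \<longlonglongrightarrow> 0" "\<And>i. 0 < X i" and t: "0 < t"
  shows "filterlim (\<lambda>i. Suc (nat \<lfloor>t / (X i)\<^sup>2\<rfloor>)) at_top sequentially"
    and "(\<lambda>i. X i * sqrt (real (Suc (nat \<lfloor>t / (X i)\<^sup>2\<rfloor>)))) \<longlonglongrightarrow> sqrt t"
proof -
  let ?n = "\<lambda>i. Suc (nat \<lfloor>t / (X i)\<^sup>2\<rfloor>)"
  have bounds: "t \<le> (X i)\<^sup>2 * real (?n i)" "(X i)\<^sup>2 * real (?n i) \<le> t + (X i)\<^sup>2" for i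
  proof -
    have p: "0 < (X i)\<^sup>2" using X(2)[of i] by simp
    have "0 \<le> t / (X i)\<^sup>2" using t by simp
    then have "real (?n i) = of_int \<lfloor>t / (X i)\<^sup>2\<rfloor> + 1" by simp
    then have "t / (X i)\<^sup>2 \<le> real (?n i)" "real (?n i) \<le> t / (X i)\<^sup>2 + 1" by linarith+
    then show "t \<le> (X i)\<^sup>2 * real (?n i)" "(X i)\<^sup>2 * real (?n i) \<le> t + (X i)\<^sup>2"
      using p mult_left_mono[of "t / (X i)\<^sup>2" "real (?n i)" "(X i)\<^sup>2"]
        mult_left_mono[of "real (?n i)" "t / (X i)\<^sup>2 + 1" "(X i)\<^sup>2"]
      by (simp_all add: distrib_left del: of_nat_Suc)
  qed
  have X2: "(\<lambda>i. (X i)\<^sup>2) \<longlonglongrightarrow> 0" using tendsto_power[OF X(1), of 2] by simp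
  have "(\<lambda>i. (X i)\<^sup>2 * real (?n i)) \<longlonglongrightarrow> t"
  proof (rule tendsto_sandwich[where f="\<lambda>_. t" and h="\<lambda>i. t + (X i)\<^sup>2"])
    show "(\<lambda>i. t + (X i)\<^sup>2) \<longlonglongrightarrow> t" using tendsto_add[OF tendsto_const X2, of t] by simp
    show "(\<lambda>i. t) \<longlonglongrightarrow> t" by simp
    show "eventually (\<lambda>i. t \<le> (X i)\<^sup>2 * real (?n i)) sequentially"
      "eventually (\<lambda>i. (X i)\<^sup>2 * real (?n i) \<le> t + (X i)\<^sup>2) sequentially"
      by (rule always_eventually, rule allI, rule bounds)+
  qed
  then have "(\<lambda>i. sqrt ((X i)\<^sup>2 * real (?n i))) \<longlonglongrightarrow> sqrt t" by (rule tendsto_real_sqrt)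
  moreover have "sqrt ((X i)\<^sup>2 * real (?n i)) = X i * sqrt (real (?n i))" for i
    using X(2)[of i] by (simp add: real_sqrt_mult)
  ultimately show "(\<lambda>i. X i * sqrt (real (?n i))) \<longlonglongrightarrow> sqrt t" by simp
  have "filterlim (\<lambda>i. (X i)\<^sup>2) (at_right 0) sequentially"
    using X2 X(2) by (auto simp: filterlim_at less_imp_neq[THEN not_sym] intro!: always_eventually)
  then have "filterlim (\<lambda>i. t * inverse ((X i)\<^sup>2)) at_top sequentially"
    using t by (intro filterlim_tendsto_pos_mult_at_top[OF tendsto_const]
      filterlim_compose[OF filterlim_inverse_at_top_right])
  then have "filterlim (\<lambda>i. real (?n i)) at_top sequentially"
  proof (rule filterlim_at_top_mono)
    show "eventually (\<lambda>i. t * inverse ((X i)\<^sup>2) \<le> real (?n i)) sequentially"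
      using bounds(1) X(2)
      by (auto intro!: always_eventually
        simp: divide_inverse[symmetric] pos_divide_le_eq mult.commute
          less_imp_neq[THEN not_sym] simp del: of_nat_Suc)
  qed
  then show "filterlim ?n at_top sequentially"
    by (simp only: filterlim_sequentially_iff_filterlim_real)
qed

section \<open>The limit by dominated convergence\<close>

theorem theorem1p3:
  fixes m :: "'a measure" and T :: "'a \<Rightarrow> 'a" and f :: "'a \<Rightarrow> real"
    and \<sigma> \<delta> M C :: real and I :: "real \<Rightarrow> real"
  assumes system: "ergodic_mps m T"
    and f_integrable: "integrable m f"
    and f_mean: "(\<integral>x. f x \<partial>m) = 0"
    and \<sigma>_pos: "0 < \<sigma>"
    and CLT: "weak_conv_m (\<lambda>n. distr m borel (\<lambda>x. birkhoff_sum T f n x / (\<sigma> * sqrt (real n))))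
      std_normal_distribution"
    and constants_pos: "0 < \<delta>" "0 < M" "0 < C"
    and I_C2: "I C2_differentiable_on {-\<delta><..<\<delta>}"
    and I_nonneg: "\<And>t. t \<in> {-\<delta><..<\<delta>} \<Longrightarrow> 0 \<le> I t"
    and I_at_0: "I 0 = 0" "deriv I 0 = 0" "deriv (deriv I) 0 > 0"
    and LD: "\<And>n \<epsilon>. \<lbrakk>1 \<le> n; \<epsilon> \<in> {0<..<\<delta>}; \<epsilon> > M / real n\<rbrakk> \<Longrightarrow>
      Lambda_plus m T f n \<epsilon> \<le> C * exp (- I \<epsilon> * real n) \<and>
      Lambda_minus m T f n \<epsilon> \<le> C * exp (- I (- \<epsilon>) * real n)"
  shows "((\<lambda>\<epsilon>. ennreal (\<epsilon>\<^sup>2) * Lambda_total m T f \<epsilon>) \<longlongrightarrow> ennreal (\<sigma>\<^sup>2)) (at_right 0)"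
proof -
  interpret ergodic_mps m T by (rule system)
  interpret N: real_distribution std_normal_distribution by (rule real_dist_normal_dist)
  have S_meas [measurable]: "birkhoff_sum T f n \<in> borel_measurable m" for n
    using T_measurable f_integrable by (intro birkhoff_sum_measurable) auto
  define \<mu> where
    "\<mu> n = distr m borel (\<lambda>x. birkhoff_sum T f n x / (\<sigma> * sqrt (real n)))" for n
  have \<mu>: "real_distribution (\<mu> n)" for n
    unfolding \<mu>_def by (intro real_distribution_distr) simp
  interpret \<mu>: real_distribution "\<mu> n" for n by (rule \<mu>)
  \<comment> \<open>\<open>P n \<epsilon>\<close> merges both deviations, so that a single series
    and a single two-sided tail remain.\<close>
  define P where "P n \<epsilon> = Lambda_plus m T f n \<epsilon> + Lambda_minus m T f n \<epsilon>" for n \<epsilon>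
  have P_eq: "P n \<epsilon> = measure (\<mu> n) {y. \<epsilon> * sqrt (real n) / \<sigma> \<le> \<bar>y\<bar>}" if "1 \<le> n" "0 < \<epsilon>" for n \<epsilon>
    unfolding P_def \<mu>_def using that \<sigma>_pos
    by (intro Lambda_plus_add_Lambda_minus) (auto intro: prob_space_axioms)
  have total: "Lambda_total m T f \<epsilon> = (\<Sum>k. ennreal (P (Suc k) \<epsilon>))" for \<epsilon>
    unfolding Lambda_total_def P_def
    by (subst suminf_add) (auto simp: Lambda_plus_def Lambda_minus_def)
  have diffuse: "measure std_normal_distribution {y} = 0" for y
    by (simp add: measure_def emeasure_density nn_integral_0_iff_AE AE_lborel_singleton)
  obtain c r where cr: "0 < c" "0 < r" "r \<le> \<delta>" "\<And>t. \<bar>t\<bar> < r \<Longrightarrow> c * t\<^sup>2 \<le> I t"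
    using C2_quadratic_lower_bound[OF I_C2 constants_pos(1) I_at_0] by metis
  \<comment> \<open>The summand \<open>2 * C\<close> absorbs the two large deviation bounds;
    \<open>exp (c * M)\<close> makes the majorant at least 1 when \<epsilon> is at most
    \<open>M / n\<close>.\<close>
  define K where "K = exp (c * M) + 2 * C"
  have K: "0 \<le> K" using constants_pos by (simp add: K_def add_nonneg_nonneg)
  \<comment> \<open>For \<open>\<epsilon> \<le> M / n\<close> the large deviation bound is void, but then \<open>\<epsilon>\<^sup>2 n \<le> M\<close>.\<close>
  have P_bound: "P n \<epsilon> \<le> K * exp (- c * (\<epsilon>\<^sup>2 * real n))"
    if n: "1 \<le> n" and \<epsilon>: "0 < \<epsilon>" "\<epsilon> < min r 1" for n \<epsilon>
  proof (cases "\<epsilon> > M / real n")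
    case True
    have tail: "C * exp (- I s * real n) \<le> C * exp (- c * (\<epsilon>\<^sup>2 * real n))"
      if "s = \<epsilon> \<or> s = - \<epsilon>" for s
    proof -
      have "c * \<epsilon>\<^sup>2 \<le> I s" using cr(4)[of s] that \<epsilon> by auto
      then have "c * \<epsilon>\<^sup>2 * real n \<le> I s * real n" by (rule mult_right_mono) simp
      then show ?thesis using constants_pos by (simp add: mult.assoc)
    qed
    have "P n \<epsilon> \<le> 2 * C * exp (- c * (\<epsilon>\<^sup>2 * real n))"
      using LD[OF n _ True] \<epsilon> cr(3) tail[of \<epsilon>] tail[of "- \<epsilon>"] unfolding P_def by auto
    also have "\<dots> \<le> K * exp (- c * (\<epsilon>\<^sup>2 * real n))"
      unfolding K_def by (intro mult_right_mono) auto
    finally show ?thesis .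
  next
    case False
    then have "\<epsilon> * real n \<le> M" using n by (simp add: field_simps)
    \<comment> \<open>This is where the restriction of \<epsilon> to values below 1 enters.\<close>
    then have "\<epsilon> * (\<epsilon> * real n) \<le> 1 * M"
      using \<epsilon> constants_pos by (intro mult_mono) auto
    then have "c * (\<epsilon>\<^sup>2 * real n) \<le> c * M"
      using cr(1) by (simp add: power2_eq_square mult.assoc)
    then have "1 \<le> exp (c * M) * exp (- c * (\<epsilon>\<^sup>2 * real n))"
      by (simp flip: exp_add)
    also have "\<dots> \<le> K * exp (- c * (\<epsilon>\<^sup>2 * real n))"
      unfolding K_def using constants_pos by (intro mult_right_mono) auto
    finally show ?thesis using P_eq[OF n \<epsilon>(1)] \<mu>.prob_le_1[of n] by (metis order_trans)
  qed
  let ?G = "\<lambda>t. ennreal (measure std_normal_distribution {y. sqrt t / \<sigma> \<le> \<bar>y\<bar>}) * indicator {0..} t"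
  have G_meas: "?G \<in> borel_measurable lborel"
  proof -
    \<comment> \<open>The tail as a function of \<open>t\<close> is the measure of the sections of a
      closed planar set, hence measurable.\<close>
    have "(\<lambda>t. emeasure std_normal_distribution (Pair t -` {p. sqrt (fst p) / \<sigma> \<le> \<bar>snd p\<bar>}))
        \<in> borel_measurable borel"
    proof (rule N.measurable_emeasure_Pair)
      have "closed {p::real \<times> real. sqrt (fst p) / \<sigma> \<le> \<bar>snd p\<bar>}"
        using \<sigma>_pos by (intro closed_Collect_le continuous_intros) auto
      then show "{p. sqrt (fst p) / \<sigma> \<le> \<bar>snd p\<bar>} \<in> sets (borel \<Otimes>\<^sub>M std_normal_distribution)"
        by (simp only: borel_prod borel_closed
          sets_pair_measure_cong[OF refl N.events_eq_borel, of "borel :: real measure"])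
    qed
    then show ?thesis by (simp add: N.emeasure_eq_measure)
  qed
  have "(\<integral>\<^sup>+t. ?G t \<partial>lborel) = (\<integral>\<^sup>+y. ennreal (\<sigma>\<^sup>2 * y\<^sup>2) \<partial>std_normal_distribution)"
    using nn_integral_emeasure_abs_tail[of std_normal_distribution \<sigma>] \<sigma>_pos
    by (simp add: N.emeasure_eq_measure N.sigma_finite_measure_axioms)
  also have "\<dots> = ennreal (\<integral>y. \<sigma>\<^sup>2 * y\<^sup>2 \<partial>std_normal_distribution)"
    using std_normal_distribution_even_moments(2)[of 1] by (intro nn_integral_eq_integral) auto
  also have "(\<integral>y. \<sigma>\<^sup>2 * y\<^sup>2 \<partial>std_normal_distribution) = \<sigma>\<^sup>2"
    using std_normal_distribution_even_moments(1)[of 1] by simp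
  finally have G_int: "(\<integral>\<^sup>+t. ?G t \<partial>lborel) = ennreal (\<sigma>\<^sup>2)" .
  show ?thesis
  \<comment> \<open>Dominated convergence needs sequences; keeping them below \<open>min r 1\<close>
    makes \<open>P_bound\<close> available for every term.\<close>
  proof (rule tendsto_at_right_sequentially)
    show "(0::real) < min r 1" using cr by simp
    fix X :: "nat \<Rightarrow> real"
    assume X: "\<And>i. 0 < X i" "\<And>i. X i < min r 1" "X \<longlonglongrightarrow> 0"
    let ?n = "\<lambda>i t. Suc (nat \<lfloor>t / (X i)\<^sup>2\<rfloor>)"
    have eq: "ennreal ((X i)\<^sup>2) * Lambda_total m T f (X i)
        = (\<integral>\<^sup>+t. ennreal (P (?n i t) (X i)) * indicator {0..} t \<partial>lborel)" for i
      unfolding total using X(1)[of i]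
        suminf_eq_nn_integral_floor[of "(X i)\<^sup>2" "\<lambda>k. ennreal (P (Suc k) (X i))"] by simp
    have "(\<lambda>i. \<integral>\<^sup>+t. ennreal (P (?n i t) (X i)) * indicator {0..} t \<partial>lborel)
        \<longlonglongrightarrow> (\<integral>\<^sup>+t. ?G t \<partial>lborel)"
    proof (rule nn_integral_dominated_convergence)
      show "(\<lambda>t. ennreal (P (?n i t) (X i)) * indicator {0..} t) \<in> borel_measurable lborel" for i
      proof -
        \<comment> \<open>The integrand factors through the integer floor, and every function on a
          discrete space is measurable.\<close>
        have "(\<lambda>t. (\<lambda>k. ennreal (P (Suc (nat k)) (X i))) \<lfloor>t / (X i)\<^sup>2\<rfloor>) \<in> borel_measurable lborel"
          by (rule measurable_compose[where N="count_space UNIV"]) measurable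
        then show ?thesis by measurable
      qed
      show "?G \<in> borel_measurable lborel" by (rule G_meas)
      show "(\<lambda>t. ennreal (K * exp (- c * t)) * indicator {0..} t) \<in> borel_measurable lborel"
        by measurable
      show "(\<integral>\<^sup>+t. ennreal (K * exp (- c * t)) * indicator {0..} t \<partial>lborel) < \<infinity>"
        by (rule nn_integral_exp_finite[OF K cr(1)])
      show "AE t in lborel. ennreal (P (?n i t) (X i)) * indicator {0..} t
          \<le> ennreal (K * exp (- c * t)) * indicator {0..} t" for i
      proof (intro AE_I2 mult_right_mono ennreal_leI)
        fix t
        \<comment> \<open>The index rounds upwards, so the decaying exponential is largest at
          \<open>t\<close> itself. For negative \<open>t\<close>, \<open>nat\<close> returns 0 and
          the inequality still holds, so no case split is needed.\<close>
        have "t / (X i)\<^sup>2 \<le> real (?n i t)" by linarith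
        then have "t \<le> (X i)\<^sup>2 * real (?n i t)"
          using X(1)[of i] by (simp add: pos_divide_le_eq mult.commute del: of_nat_Suc)
        then have "exp (- c * ((X i)\<^sup>2 * real (?n i t))) \<le> exp (- c * t)" using cr(1) by simp
        then show "P (?n i t) (X i) \<le> K * exp (- c * t)"
          using order_trans[OF P_bound[of "?n i t" "X i"] mult_left_mono[OF _ K]] X(1,2)[of i]
          by simp
      qed simp
      \<comment> \<open>The null point \<open>t = 0\<close> is discarded because
        \<open>weak_conv_abs_tail\<close> asks for a positive limit threshold; for negative
        \<open>t\<close> both sides vanish.\<close>
      show "AE t in lborel. (\<lambda>i. ennreal (P (?n i t) (X i)) * indicator {0..} t) \<longlonglongrightarrow> ?G t"
      proof (rule AE_mp[OF AE_lborel_singleton[of 0]], intro AE_I2 impI)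
        fix t :: real assume "t \<noteq> 0"
        show "(\<lambda>i. ennreal (P (?n i t) (X i)) * indicator {0..} t) \<longlonglongrightarrow> ?G t"
        proof (cases "0 \<le> t")
          case True
          with \<open>t \<noteq> 0\<close> have t: "0 < t" by simp
          have "(\<lambda>i. X i * sqrt (real (?n i t)) / \<sigma>) \<longlonglongrightarrow> sqrt t / \<sigma>"
            using \<sigma>_pos by (intro tendsto_divide tendsto_mult_sqrt_floor(2)[OF X(3,1) t]) auto
          then have "(\<lambda>i. measure (\<mu> (?n i t)) {y. X i * sqrt (real (?n i t)) / \<sigma> \<le> \<bar>y\<bar>})
              \<longlonglongrightarrow> measure std_normal_distribution {y. sqrt t / \<sigma> \<le> \<bar>y\<bar>}"
            using t \<sigma>_pos CLT
            by (intro weak_conv_abs_tail[OF \<mu> N.real_distribution_axioms _ diffuse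
                  tendsto_mult_sqrt_floor(1)[OF X(3,1) t]]) (auto simp: \<mu>_def[abs_def])
          then show ?thesis using True X(1) by (simp add: P_eq)
        qed simp
      qed
    qed
    then show "(\<lambda>i. ennreal ((X i)\<^sup>2) * Lambda_total m T f (X i)) \<longlonglongrightarrow> ennreal (\<sigma>\<^sup>2)"
      by (simp only: eq G_int)
  qed
qed

end
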